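(* There is a simple model $M$ such that there is no $M$-predicate $H$ with $\mathrm{True}_M^+=\Phi_M(H)\cap\mathrm{Sent}_M^+$ (i.e. $M$ satisfies T-Tarski$^+$), but there is an $M$-predicate $H$ with $\Phi_M(H)=\mathrm{False}_M$ (i.e. $M$ does not satisfy F-Tarski).
   Context: For a non-empty set $\Sigma$ of symbols, $\Sigma^\ast$ is the set of all finite strings over $\Sigma$, including the empty string; $XY$ denotes concatenation. Fix a symbol $\sharp$. A simple model is a pair $M=(\Sigma_M,\Phi_M)$ where $\Sigma_M$ is a set of symbols with $\sharp\in\Sigma_M$, and, putting $\mathrm{Pred}_M=\{X\sharp : X\in\Sigma_M^\ast \text{ and } X \text{ does not contain } \sharp\}$, $\Phi_M$ is a function $\mathrm{Pred}_M\to\mathcal{P}(\Sigma_M^\ast)$. Elements of $\mathrm{Pred}_M$ are called $M$-predicates. $\mathrm{Sent}_M=\{HX : H\in\mathrm{Pred}_M, X\in\Sigma_M^\ast\}$ is the set of $M$-sentences (the decomposition $HX$ is unique), and $\mathrm{Sent}_M^+=\mathrm{Sent}_M\setminus\mathrm{Pred}_M$. $\mathrm{True}_M=\{HX\in\mathrm{Sent}_M : H\in\mathrm{Pred}_M, X\in\Phi_M(H)\}$, $\mathrm{True}_M^+=\mathrm{True}_M\cap\mathrm{Sent}_M^+$, $\mathrm{False}_M=\mathrm{Sent}_M\setminus\mathrm{True}_M$. *)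

theory Defs
  imports Main "HOL-Library.FuncSet"
begin

text \<open>
  Strings over an alphabet \<open>S\<close> are the elements of \<^term>\<open>lists S\<close>; concatenation is \<open>@\<close>.
  The type \<open>'a\<close> is the universe of symbols, and the fixed symbol \<open>\<sharp>\<close> is the argument
  \<open>sharp\<close> of all definitions below.
\<close>

record 'a model =
  Alph :: "'a set"
  Phi :: "'a list \<Rightarrow> 'a list set"

definition Pred :: "'a \<Rightarrow> 'a model \<Rightarrow> 'a list set" where
  "Pred sharp M = {X @ [sharp] | X. X \<in> lists (Alph M) \<and> sharp \<notin> set X}"

text \<open>
  The extensional function space makes \<^term>\<open>Phi M\<close> a function with domain exactly
  \<^term>\<open>Pred sharp M\<close>: it has no freedom on strings that are not predicates.
\<close>

definition simple_model :: "'a \<Rightarrow> 'a model \<Rightarrow> bool" where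
  "simple_model sharp M \<longleftrightarrow>
     sharp \<in> Alph M \<and> Phi M \<in> Pred sharp M \<rightarrow>\<^sub>E Pow (lists (Alph M))"

definition Sent :: "'a \<Rightarrow> 'a model \<Rightarrow> 'a list set" where
  "Sent sharp M = {H @ X | H X. H \<in> Pred sharp M \<and> X \<in> lists (Alph M)}"

definition Sent_plus :: "'a \<Rightarrow> 'a model \<Rightarrow> 'a list set" where
  "Sent_plus sharp M = Sent sharp M - Pred sharp M"

definition True_sent :: "'a \<Rightarrow> 'a model \<Rightarrow> 'a list set" where
  "True_sent sharp M = {H @ X | H X. H \<in> Pred sharp M \<and> X \<in> lists (Alph M) \<and> X \<in> Phi M H}"

definition True_plus :: "'a \<Rightarrow> 'a model \<Rightarrow> 'a list set" where
  "True_plus sharp M = True_sent sharp M \<inter> Sent_plus sharp M"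

definition False_sent :: "'a \<Rightarrow> 'a model \<Rightarrow> 'a list set" where
  "False_sent sharp M = Sent sharp M - True_sent sharp M"

definition T_Tarski_plus :: "'a \<Rightarrow> 'a model \<Rightarrow> bool" where
  "T_Tarski_plus sharp M \<longleftrightarrow>
     \<not> (\<exists>H \<in> Pred sharp M. True_plus sharp M = Phi M H \<inter> Sent_plus sharp M)"

definition F_Tarski :: "'a \<Rightarrow> 'a model \<Rightarrow> bool" where
  "F_Tarski sharp M \<longleftrightarrow> \<not> (\<exists>H \<in> Pred sharp M. Phi M H = False_sent sharp M)"

end

theory Submission imports Defs begin

text \<open>
  Over the alphabet \<open>{\<sharp>}\<close> a string is a natural number and \<open>\<sharp>\<close> is the only predicate. Prefixing
  \<open>\<sharp>\<close> flips the parity of the length, so if \<open>\<sharp>\<close> denotes the strings of odd length, the true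
  sentences are the nonempty ones of even length and the false ones are exactly those of odd length.
\<close>

definition parity_model :: "'a \<Rightarrow> 'a model" where
  "parity_model s =
     \<lparr>Alph = {s}, Phi = (\<lambda>H\<in>{[s]}. {X \<in> lists {s}. odd (length X)})\<rparr>"

lemma Pred_parity_model: "Pred s (parity_model s) = {[s]}"
proof -
  have "X = []" if "X \<in> lists {s}" "s \<notin> set X" for X
    using that by (cases X) auto
  then show ?thesis
    by (auto simp: Pred_def parity_model_def)
qed

lemma Phi_parity_model: "Phi (parity_model s) [s] = {X \<in> lists {s}. odd (length X)}"
  by (simp add: parity_model_def)

lemma simple_model_parity_model: "simple_model s (parity_model s)"
  unfolding simple_model_def Pred_parity_model
  by (auto simp: parity_model_def)

lemma Sent_parity_model: "Sent s (parity_model s) = {s # X | X. X \<in> lists {s}}"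
  by (simp add: Sent_def Pred_parity_model) (simp add: parity_model_def)

lemma True_sent_parity_model:
  "True_sent s (parity_model s) = {s # X | X. X \<in> lists {s} \<and> odd (length X)}"
  by (auto simp: True_sent_def Pred_parity_model Phi_parity_model)
    (auto simp: parity_model_def)

lemma False_sent_parity_model:
  "False_sent s (parity_model s) = Phi (parity_model s) [s]"
proof (rule set_eqI)
  fix Y show "Y \<in> False_sent s (parity_model s) \<longleftrightarrow> Y \<in> Phi (parity_model s) [s]"
    \<comment> \<open>The empty string is no sentence, and its even length keeps it out of the
      right-hand side too. For \<open>s # X\<close> with \<open>X\<close> over \<open>{s}\<close>,
      both sides say that \<open>X\<close> has even length.\<close>
    by (cases Y)
      (auto simp: False_sent_def Sent_parity_model True_sent_parity_model Phi_parity_model)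
qed

lemma T_Tarski_plus_parity_model: "T_Tarski_plus s (parity_model s)"
proof -
  \<comment> \<open>As \<open>[s]\<close> is the only predicate, one string separating truth from
    its denotation suffices. \<open>[s, s]\<close> is the shortest true sentence, and it is too long
    to be a predicate.\<close>
  have "[s, s] \<in> True_plus s (parity_model s)"
    by (simp add: True_plus_def Sent_plus_def Pred_parity_model Sent_parity_model
        True_sent_parity_model)
  moreover have "[s, s] \<notin> Phi (parity_model s) [s]"
    by (simp add: Phi_parity_model)
  ultimately show ?thesis
    by (auto simp: T_Tarski_plus_def Pred_parity_model)
qed

theorem proposition4p5:
  fixes sharp :: 'a
  shows "\<exists>M :: 'a model. simple_model sharp M \<and> T_Tarski_plus sharp M \<and> \<not> F_Tarski sharp M"
proof (intro exI conjI)
  show "\<not> F_Tarski sharp (parity_model sharp)"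
    by (simp add: F_Tarski_def Pred_parity_model False_sent_parity_model)
qed (rule simple_model_parity_model T_Tarski_plus_parity_model)+

end
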